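(* For any integers $2\le r<s$, the digraphs $\widehat{\infty}(r,s)$ and $\widehat{\infty}(s,r)$ are non-isomorphic, have the same order $n=r+s-1$, the same number of arcs $m=r+s+1$, and the same complementarity spectrum $\{0,1,\rho\}$, where $\rho$ is the largest real root of $x^n-x^{n-r}-x^{n-s}-1$.
   Context: For integers $p,q\ge2$, $\infty(p,q)$ is the digraph obtained from directed cycles $\vec C_p$ (vertices $1\to2\to\cdots\to p\to1$) and $\vec C_q$ (vertices $1'\to2'\to\cdots\to q'\to1'$) by identifying vertices $1$ and $1'$. $\widehat{\infty}(p,q)$ is $\infty(p,q)$ with the additional arc $(p,2')$ from the last vertex of the first cycle to the second vertex of the second cycle. For a real matrix $A$, $\lambda\in\mathbb{R}$ is a complementarity eigenvalue if there is a nonzero $x\geq\mathbf{o}$ with $Ax\geq\lambda x$ and $\langle x,Ax-\lambda x\rangle=0$; the set of these is $\Pi(A)$, and the complementarity spectrum of a digraph $D$ is $\Pi(D):=\Pi(A(D))$ with $A(D)$ the $0/1$ adjacency matrix. *)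

theory Defs
  imports
    Complex_Main
    "HOL-Computational_Algebra.Polynomial"
    "Graph_Theory.Graph_Theory"
    "Jordan_Normal_Form.Matrix"
begin

definition comp_eigenvalue :: "real mat \<Rightarrow> real \<Rightarrow> bool" where
  "comp_eigenvalue A l \<longleftrightarrow>
     (\<exists>x \<in> carrier_vec (dim_col A). x \<noteq> 0\<^sub>v (dim_col A) \<and> 0\<^sub>v (dim_col A) \<le> x \<and>
        l \<cdot>\<^sub>v x \<le> A *\<^sub>v x \<and> x \<bullet> (A *\<^sub>v x - l \<cdot>\<^sub>v x) = 0)"

definition comp_spectrum :: "real mat \<Rightarrow> real set" where
  "comp_spectrum A = {l. comp_eigenvalue A l}"

text \<open>Rows and columns are indexed by the vertices in increasing order; any other enumeration
  gives a permutation-similar matrix, hence the same complementarity spectrum.\<close>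

definition adj_mat :: "('a :: linorder, 'b) pre_digraph \<Rightarrow> real mat" where
  "adj_mat D = (let vs = sorted_list_of_set (verts D) in
     mat (length vs) (length vs) (\<lambda>(i, j). if (vs ! i, vs ! j) \<in> arcs_ends D then 1 else 0))"

definition digraph_comp_spectrum :: "('a :: linorder, 'b) pre_digraph \<Rightarrow> real set" where
  "digraph_comp_spectrum D = comp_spectrum (adj_mat D)"

definition dicycle :: "nat \<Rightarrow> nat pair_pre_digraph" where
  "dicycle p = \<lparr> pverts = {1..p}, parcs = {(i, i + 1) | i. 1 \<le> i \<and> i < p} \<union> {(p, 1)} \<rparr>"

text \<open>The label in \<open>\<infinity>(p, q)\<close> of the vertex \<open>j'\<close> of the second cycle: \<open>1'\<close> is identified with
  \<open>1\<close>, and \<open>2', \<dots>, q'\<close> become the new vertices \<open>p + 1, \<dots>, p + q - 1\<close>.\<close>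

definition second_label :: "nat \<Rightarrow> nat \<Rightarrow> nat" where
  "second_label p j = (if j = 1 then 1 else p + j - 1)"

definition infty_digraph :: "nat \<Rightarrow> nat \<Rightarrow> nat pair_pre_digraph" where
  "infty_digraph p q =
     \<lparr> pverts = pverts (dicycle p) \<union> second_label p ` pverts (dicycle q),
       parcs = parcs (dicycle p) \<union>
         map_prod (second_label p) (second_label p) ` parcs (dicycle q) \<rparr>"

definition hat_infty_digraph :: "nat \<Rightarrow> nat \<Rightarrow> nat pair_pre_digraph" where
  "hat_infty_digraph p q =
     \<lparr> pverts = pverts (infty_digraph p q),
       parcs = insert (p, second_label p 2) (parcs (infty_digraph p q)) \<rparr>"

lemma pverts_hat_infty:
  assumes "2 \<le> p" "2 \<le> q"
  shows "pverts (hat_infty_digraph p q) = {1..<p + q}"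
proof -
  have "v \<in> {1..p} \<union> second_label p ` {1..q}" if "1 \<le> v" "v < p + q" for v
  proof (cases "v \<le> p")
    case False
    then have "v = second_label p (v + 1 - p)" "v + 1 - p \<in> {1..q}"
      using that by (auto simp: second_label_def)
    then show ?thesis by blast
  qed (use that in auto)
  moreover have "1 \<le> v \<and> v < p + q" if "v \<in> {1..p} \<union> second_label p ` {1..q}" for v
    using that assms by (auto simp: second_label_def)
  ultimately have "{1..p} \<union> second_label p ` {1..q} = {1..<p + q}"
    unfolding set_eq_iff atLeastLessThan_iff by blast
  then show ?thesis
    by (simp add: hat_infty_digraph_def infty_digraph_def dicycle_def)
qed

lemma pair_digraph_hat_infty:
  assumes "2 \<le> p" "2 \<le> q"
  shows "pair_digraph (hat_infty_digraph p q)"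
proof -
  have "{(i, i + 1) | i. 1 \<le> i \<and> i < m} = (\<lambda>i. (i, i + 1)) ` {1..<m}" for m :: nat
    by auto
  then have "finite (parcs (dicycle m))" for m
    by (simp add: dicycle_def)
  then have fin: "finite (parcs (hat_infty_digraph p q))"
    by (simp add: hat_infty_digraph_def infty_digraph_def)
  show ?thesis
  proof
    show "finite (pverts (hat_infty_digraph p q))"
      by (simp add: hat_infty_digraph_def infty_digraph_def dicycle_def)
    show "finite (parcs (hat_infty_digraph p q))"
      by (rule fin)
  next
    fix e assume "e \<in> parcs (hat_infty_digraph p q)"
    with assms show "fst e \<in> pverts (hat_infty_digraph p q)"
      and "snd e \<in> pverts (hat_infty_digraph p q)"
      and "fst e \<noteq> snd e"
      unfolding pverts_hat_infty[OF assms]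
      by (auto simp: hat_infty_digraph_def infty_digraph_def dicycle_def second_label_def
          split: if_splits)
  qed
qed

end

theory Submission
  imports Defs
begin

text \<open>Reading the complementarity conditions along the arcs of the hatted digraph, a positive
  complementarity eigenvalue \<open>l\<close> forces the entry at vertex \<open>1\<close> to be positive. Every other vertex
  lies on a path along which the entries grow by the factor \<open>l\<close>, so everything is determined by
  which of the two out-neighbours of vertex \<open>1\<close> belong to the support: if only one does, then
  \<open>l\<^sup>p = 1\<close> or \<open>l\<^sup>q = 1\<close>, and if both do, eliminating the entries leaves the characteristic
  equation, which is symmetric in \<open>p\<close> and \<open>q\<close> and has exactly one positive root.
  On the other hand, an isomorphism must preserve vertex \<open>1\<close> (the only one with two in- and two
  out-neighbours), then the other vertex with two out-neighbours, and then the whole path between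
  these two vertices, whose length is \<open>p - 1\<close>.\<close>

section \<open>Complementarity eigenvalues\<close>

text \<open>The inner product is a sum of nonnegative terms, so it vanishes iff every term does.
  This turns orthogonality into a condition at each index of the support.\<close>

lemma comp_eigenvalue_iff:
  assumes A: "A \<in> carrier_mat n n"
  shows "comp_eigenvalue A l \<longleftrightarrow>
    (\<exists>x. (\<forall>i<n. 0 \<le> x i) \<and> (\<exists>i<n. 0 < x i) \<and> (\<forall>i<n. l * x i \<le> (\<Sum>j<n. A $$ (i, j) * x j)) \<and>
       (\<forall>i<n. 0 < x i \<longrightarrow> (\<Sum>j<n. A $$ (i, j) * x j) = l * x i))"
    (is "_ \<longleftrightarrow> (\<exists>x. ?nonneg x \<and> ?pos x \<and> ?super x \<and> ?compl x)")
proof -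
  have mult: "(A *\<^sub>v x) $ i = (\<Sum>j<n. A $$ (i, j) * x $ j)"
    if "x \<in> carrier_vec n" "i < n" for x i
    using that A by (auto simp: scalar_prod_def lessThan_atLeast0 intro!: sum.cong)
  have dimA: "dim_row A = n" "dim_col A = n"
    using A by auto
  have inner: "x \<bullet> (A *\<^sub>v x - l \<cdot>\<^sub>v x) = (\<Sum>i<n. x $ i * ((\<Sum>j<n. A $$ (i, j) * x $ j) - l * x $ i))"
    if "x \<in> carrier_vec n" for x
    using that dimA
    by (auto simp: scalar_prod_def[of x] lessThan_atLeast0 mult[OF that, unfolded lessThan_atLeast0]
        simp del: index_mult_mat_vec intro!: sum.cong)
  show ?thesis
  proof
    assume "comp_eigenvalue A l"
    then obtain x where x: "x \<in> carrier_vec n" "x \<noteq> 0\<^sub>v n" "0\<^sub>v n \<le> x"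
      "l \<cdot>\<^sub>v x \<le> A *\<^sub>v x" "x \<bullet> (A *\<^sub>v x - l \<cdot>\<^sub>v x) = 0"
      unfolding comp_eigenvalue_def dimA by blast
    have nonneg: "0 \<le> x $ i" if "i < n" for i
      using x(1,3) that by (auto simp: less_eq_vec_def)
    have "\<exists>i<n. x $ i \<noteq> 0"
    proof (rule ccontr)
      assume "\<not> ?thesis"
      then have "x = 0\<^sub>v n"
        using x(1) by (intro eq_vecI) auto
      with x(2) show False ..
    qed
    then have pos: "\<exists>i<n. 0 < x $ i"
      using nonneg by force
    have super: "l * x $ i \<le> (\<Sum>j<n. A $$ (i, j) * x $ j)" if "i < n" for i
      using x(1,4) that dimA by (auto simp: less_eq_vec_def mult simp del: index_mult_mat_vec)
    have "\<forall>i\<in>{..<n}. x $ i * ((\<Sum>j<n. A $$ (i, j) * x $ j) - l * x $ i) = 0"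
      using x(5) nonneg super unfolding inner[OF x(1)]
      by (subst (asm) sum_nonneg_eq_0_iff) auto
    then have "(\<Sum>j<n. A $$ (i, j) * x $ j) = l * x $ i" if "i < n" "0 < x $ i" for i
      using that by force
    with nonneg pos super show "\<exists>x. ?nonneg x \<and> ?pos x \<and> ?super x \<and> ?compl x"
      by (intro exI[of _ "\<lambda>i. x $ i"]) blast
  next
    assume "\<exists>x. ?nonneg x \<and> ?pos x \<and> ?super x \<and> ?compl x"
    then obtain x where x: "?nonneg x" "?pos x" "?super x" "?compl x"
      by blast
    let ?v = "vec n x"
    have v: "?v \<in> carrier_vec n"
      by simp
    obtain i where "i < n" "0 < x i"
      using x(2) by blast
    then have "?v $ i \<noteq> 0\<^sub>v n $ i"
      by simp
    then have "?v \<noteq> 0\<^sub>v n"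
      by metis
    moreover have "0\<^sub>v n \<le> ?v"
      using x(1) by (auto simp: less_eq_vec_def)
    moreover have "l \<cdot>\<^sub>v ?v \<le> A *\<^sub>v ?v"
      using x(3) dimA by (auto simp: less_eq_vec_def mult[OF v] simp del: index_mult_mat_vec)
    moreover have "?v \<bullet> (A *\<^sub>v ?v - l \<cdot>\<^sub>v ?v) = 0"
      unfolding inner[OF v] using x(1,4) by (intro sum.neutral) (force simp: less_le)
    ultimately show "comp_eigenvalue A l"
      unfolding comp_eigenvalue_def dimA using v by blast
  qed
qed

text \<open>At an index with \<open>x i = 0\<close> the inequality only says that the row sum is
  nonnegative, which is automatic here; on the support it follows from the equality.\<close>

lemma comp_eigenvalue_nonneg_mat_iff:
  assumes A: "A \<in> carrier_mat n n" and nonneg: "\<And>i j. i < n \<Longrightarrow> j < n \<Longrightarrow> 0 \<le> A $$ (i, j)"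
  shows "comp_eigenvalue A l \<longleftrightarrow>
    (\<exists>x. (\<forall>i<n. 0 \<le> x i) \<and> (\<exists>i<n. 0 < x i) \<and>
       (\<forall>i<n. 0 < x i \<longrightarrow> (\<Sum>j<n. A $$ (i, j) * x j) = l * x i))"
proof -
  have "l * x i \<le> (\<Sum>j<n. A $$ (i, j) * x j)"
    if x: "\<forall>i<n. 0 \<le> x i" "\<forall>i<n. 0 < x i \<longrightarrow> (\<Sum>j<n. A $$ (i, j) * x j) = l * x i"
      and i: "i < n" for x i
  proof (cases "x i = 0")
    case True
    then show ?thesis
      using x nonneg i by (auto intro!: sum_nonneg)
  next
    case False
    then show ?thesis
      using x i by (metis less_le order_refl)
  qed
  then show ?thesis
    unfolding comp_eigenvalue_iff[OF A] by blast
qed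

text \<open>Passing from indices to vertices removes the enumeration, and for a 0/1 matrix each row
  sum becomes a sum over out-neighbours.\<close>

lemma mem_digraph_comp_spectrum_iff:
  assumes fin: "finite (verts D)"
  shows "l \<in> digraph_comp_spectrum D \<longleftrightarrow>
    (\<exists>x. (\<forall>v\<in>verts D. 0 \<le> x v) \<and> (\<exists>v\<in>verts D. 0 < x v) \<and>
       (\<forall>v\<in>verts D. 0 < x v \<longrightarrow> (\<Sum>w | w \<in> verts D \<and> (v, w) \<in> arcs_ends D. x w) = l * x v))"
    (is "_ \<longleftrightarrow> (\<exists>x. ?V x)")
proof -
  define vs where "vs = sorted_list_of_set (verts D)"
  define n where "n = length vs"
  have vs: "distinct vs" "set vs = verts D"
    using fin by (simp_all add: vs_def)
  have bij: "bij_betw ((!) vs) {..<n} (verts D)"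
    using bij_betw_nth[OF vs(1)] vs(2) by (simp add: n_def)
  have A: "adj_mat D \<in> carrier_mat n n"
    by (simp add: adj_mat_def Let_def n_def vs_def)
  have entry: "adj_mat D $$ (i, j) = (if (vs ! i, vs ! j) \<in> arcs_ends D then 1 else 0)"
    if "i < n" "j < n" for i j
    using that by (simp add: adj_mat_def Let_def n_def vs_def)
  have sum: "(\<Sum>j<n. adj_mat D $$ (i, j) * x (vs ! j)) =
      (\<Sum>w | w \<in> verts D \<and> (vs ! i, w) \<in> arcs_ends D. x w)" if "i < n" for i and x :: "'a \<Rightarrow> real"
  proof -
    have "(\<Sum>j<n. adj_mat D $$ (i, j) * x (vs ! j)) =
        (\<Sum>j<n. if (vs ! i, vs ! j) \<in> arcs_ends D then x (vs ! j) else 0)"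
      using that by (intro sum.cong) (auto simp: entry)
    also have "\<dots> = (\<Sum>w\<in>verts D. if (vs ! i, w) \<in> arcs_ends D then x w else 0)"
      by (rule sum.reindex_bij_betw[OF bij])
    also have "\<dots> = (\<Sum>w | w \<in> verts D \<and> (vs ! i, w) \<in> arcs_ends D. x w)"
      using fin by (simp add: sum.inter_filter)
    finally show ?thesis .
  qed
  define Y where "Y y \<longleftrightarrow> (\<forall>i<n. 0 \<le> y i) \<and> (\<exists>i<n. 0 < y i) \<and>
      (\<forall>i<n. 0 < y i \<longrightarrow> (\<Sum>j<n. adj_mat D $$ (i, j) * y j) = l * y i)" for y
  have V: "?V x \<longleftrightarrow> Y (\<lambda>i. x (vs ! i))" for x
    by (simp add: Y_def sum vs(2)[symmetric] all_set_conv_all_nth Bex_def in_set_conv_nth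
        n_def[symmetric] cong: conj_cong) blast
  have "\<exists>x. ?V x" if "Y y" for y
  proof -
    \<comment> \<open>An index vector is transported to the vertices by inverting the enumeration
      \<open>vs\<close>.\<close>
    define x where "x v = y (the_inv_into {..<n} ((!) vs) v)" for v
    have x: "x (vs ! i) = y i" if "i < n" for i
      using that bij by (simp add: x_def bij_betw_def the_inv_into_f_f)
    have "Y (\<lambda>i. x (vs ! i)) \<longleftrightarrow> Y y"
      unfolding Y_def by (simp add: x cong: conj_cong)
    with that show ?thesis
      unfolding V by blast
  qed
  then have "(\<exists>x. ?V x) \<longleftrightarrow> (\<exists>y. Y y)"
    unfolding V by blast
  moreover have "0 \<le> adj_mat D $$ (i, j)" if "i < n" "j < n" for i j
    using that by (simp add: entry)
  then have "l \<in> digraph_comp_spectrum D \<longleftrightarrow> (\<exists>y. Y y)"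
    unfolding digraph_comp_spectrum_def comp_spectrum_def mem_Collect_eq Y_def
    by (rule comp_eigenvalue_nonneg_mat_iff[OF A])
  ultimately show ?thesis
    by simp
qed

section \<open>The hatted digraphs\<close>

text \<open>The consecutive arcs include the additional arc \<open>(p, p + 1)\<close>, so this displays the digraph as
  a Hamiltonian cycle with two chords at vertex \<open>1\<close>.\<close>

lemma parcs_hat_infty:
  assumes "2 \<le> p" "2 \<le> q"
  shows "parcs (hat_infty_digraph p q) =
    (\<lambda>i. (i, i + 1)) ` {1..<p + q - 1} \<union> {(p + q - 1, 1), (p, 1), (1, p + 1)}"
proof -
  have cycle: "(u, v) \<in> parcs (dicycle m) \<longleftrightarrow> 1 \<le> u \<and> u < m \<and> v = u + 1 \<or> u = m \<and> v = 1"
    for u v m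
    by (auto simp: dicycle_def)
  have "(u, v) \<in> parcs (hat_infty_digraph p q) \<longleftrightarrow>
      u = p \<and> v = second_label p 2 \<or> (u, v) \<in> parcs (dicycle p) \<or>
      (\<exists>i j. u = second_label p i \<and> v = second_label p j \<and> (i, j) \<in> parcs (dicycle q))" for u v
    by (auto simp: hat_infty_digraph_def infty_digraph_def)
  moreover have "second_label p 2 = p + 1"
    by (simp add: second_label_def)
  moreover have "(\<exists>i j. u = second_label p i \<and> v = second_label p j \<and>
      (1 \<le> i \<and> i < q \<and> j = i + 1 \<or> i = q \<and> j = 1)) \<longleftrightarrow>
      (\<exists>i. u = second_label p i \<and> v = second_label p (i + 1) \<and> 1 \<le> i \<and> i < q) \<or>
      u = second_label p q \<and> v = second_label p 1" for u v
    by blast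
  ultimately have arc: "(u, v) \<in> parcs (hat_infty_digraph p q) \<longleftrightarrow>
      u = p \<and> v = p + 1 \<or> 1 \<le> u \<and> u < p \<and> v = u + 1 \<or> u = p \<and> v = 1 \<or>
      (\<exists>i. u = second_label p i \<and> v = second_label p (i + 1) \<and> 1 \<le> i \<and> i < q) \<or>
      u = second_label p q \<and> v = second_label p 1" for u v
    unfolding cycle by (simp only: disj_assoc)
  \<comment> \<open>In the second cycle without its closing arc, \<open>i = 1\<close> gives the
    chord from the shared vertex; every other label is shifted by \<open>p - 1\<close>.\<close>
  have second: "(\<exists>i. u = second_label p i \<and> v = second_label p (i + 1) \<and> 1 \<le> i \<and> i < q) \<longleftrightarrow>
      u = 1 \<and> v = p + 1 \<or> p < u \<and> u < p + q - 1 \<and> v = u + 1" for u v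
  proof
    assume "u = 1 \<and> v = p + 1 \<or> p < u \<and> u < p + q - 1 \<and> v = u + 1"
    then show "\<exists>i. u = second_label p i \<and> v = second_label p (i + 1) \<and> 1 \<le> i \<and> i < q"
    proof
      assume "u = 1 \<and> v = p + 1"
      then show ?thesis
        using assms by (intro exI[of _ 1]) (auto simp: second_label_def)
    next
      assume "p < u \<and> u < p + q - 1 \<and> v = u + 1"
      then show ?thesis
        by (intro exI[of _ "u + 1 - p"]) (auto simp: second_label_def)
    qed
  qed (auto simp: second_label_def split: if_splits)
  have "(u, v) \<in> parcs (hat_infty_digraph p q) \<longleftrightarrow>
      1 \<le> u \<and> u < p + q - 1 \<and> v = u + 1 \<or> u = p + q - 1 \<and> v = 1 \<or> u = p \<and> v = 1 \<or>
      u = 1 \<and> v = p + 1" for u v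
    unfolding arc second using assms by (auto simp: second_label_def)
  then show ?thesis
    by (auto simp: set_eq_iff image_iff)
qed

lemma card_parcs_hat_infty:
  assumes "2 \<le> p" "2 \<le> q"
  shows "card (parcs (hat_infty_digraph p q)) = p + q + 1"
proof -
  let ?I = "(\<lambda>i::nat. (i, i + 1)) ` {1..<p + q - 1}" and ?T = "{(p + q - 1, 1), (p, 1), (1, p + 1)}"
  have "card ?I = p + q - 2"
    by (subst card_image) (auto simp: inj_on_def)
  moreover have "card ?T = 3"
    using assms by auto
  moreover have "?I \<inter> ?T = {}"
    using assms by auto
  ultimately show ?thesis
    unfolding parcs_hat_infty[OF assms] using assms by (subst card_Un_disjoint) auto
qed

section \<open>Non-isomorphism of the two hatted digraphs\<close>

text \<open>With \<open>fst\<close> and \<open>snd\<close> as tail and head on both sides,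
  compatibility with tails and heads forces the arc map to be the vertex map applied to both
  components.\<close>

lemma digraph_iso_imp_arc_preserving:
  assumes "digraph_iso (with_proj G) (with_proj H)"
  obtains f where "inj_on f (pverts G)" "\<And>u v. (u, v) \<in> parcs G \<Longrightarrow> (f u, f v) \<in> parcs H"
proof -
  obtain h where h: "pre_digraph.digraph_isomorphism (with_proj G) h"
    "with_proj H = app_iso h (with_proj G)"
    using assms unfolding digraph_iso_def by blast
  have H: "parcs H = iso_arcs h ` parcs G" "fst = iso_tail h" "snd = iso_head h"
    using arg_cong[OF h(2), of arcs] arg_cong[OF h(2), of tail] arg_cong[OF h(2), of head]
    by (simp_all only: with_proj_simps app_iso_simps)
  have "(iso_verts h u, iso_verts h v) \<in> parcs H" if "(u, v) \<in> parcs G" for u v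
  proof -
    have "iso_verts h (fst a) = iso_tail h (iso_arcs h a)"
      "iso_verts h (snd a) = iso_head h (iso_arcs h a)" if "a \<in> parcs G" for a
      using h(1) that by (simp_all add: pre_digraph.digraph_isomorphism_def)
    from this[OF that] have "iso_verts h u = fst (iso_arcs h (u, v))"
      "iso_verts h v = snd (iso_arcs h (u, v))"
      unfolding H(2,3)[symmetric] by (simp_all only: fst_conv snd_conv)
    then have "(iso_verts h u, iso_verts h v) = iso_arcs h (u, v)"
      by simp
    then show ?thesis
      using that H(1) by auto
  qed
  moreover have "inj_on (iso_verts h) (pverts G)"
    using h(1) by (simp add: pre_digraph.digraph_isomorphism_def)
  ultimately show ?thesis
    using that by blast
qed

lemma not_digraph_iso_hat_infty:
  assumes "2 \<le> r" "r < s"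
  shows "\<not> digraph_iso (with_proj (hat_infty_digraph r s)) (with_proj (hat_infty_digraph s r))"
proof
  assume "digraph_iso (with_proj (hat_infty_digraph r s)) (with_proj (hat_infty_digraph s r))"
  then obtain f where inj: "inj_on f (pverts (hat_infty_digraph r s))"
    and pres: "\<And>u v. (u, v) \<in> parcs (hat_infty_digraph r s) \<Longrightarrow>
      (f u, f v) \<in> parcs (hat_infty_digraph s r)"
    by (rule digraph_iso_imp_arc_preserving) blast
  have s: "2 \<le> s"
    using assms by simp
  have arc: "(u, v) \<in> parcs (hat_infty_digraph r s) \<longleftrightarrow>
      1 \<le> u \<and> u < r + s - 1 \<and> v = u + 1 \<or> u = r + s - 1 \<and> v = 1 \<or> u = r \<and> v = 1 \<or>
      u = 1 \<and> v = r + 1" for u v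
    unfolding parcs_hat_infty[OF assms(1) s] by auto
  have arc': "(u, v) \<in> parcs (hat_infty_digraph s r) \<longleftrightarrow>
      1 \<le> u \<and> u < r + s - 1 \<and> v = u + 1 \<or> u = r + s - 1 \<and> v = 1 \<or> u = s \<and> v = 1 \<or>
      u = 1 \<and> v = s + 1" for u v
    unfolding parcs_hat_infty[OF s assms(1)] by (auto simp: add.commute)
  have neq: "f u \<noteq> f v" if "u \<noteq> v" "1 \<le> u" "u < r + s" "1 \<le> v" "v < r + s" for u v
    using inj that assms by (auto simp: pverts_hat_infty inj_on_eq_iff)
  have img: "(f u, f v) \<in> parcs (hat_infty_digraph s r)"
    if "1 \<le> u \<and> u < r + s - 1 \<and> v = u + 1 \<or> u = r + s - 1 \<and> v = 1 \<or> u = r \<and> v = 1 \<or>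
      u = 1 \<and> v = r + 1" for u v
    using pres that unfolding arc by blast
  \<comment> \<open>Degrees in the target: only \<open>1\<close> and \<open>s\<close> have two
    out-neighbours, only \<open>1\<close> and \<open>s + 1\<close> have two in-neighbours.\<close>
  have two_out: "a = 1 \<or> a = s"
    if "(a, b) \<in> parcs (hat_infty_digraph s r)" "(a, c) \<in> parcs (hat_infty_digraph s r)" "b \<noteq> c"
    for a b c
    using that assms unfolding arc' by auto
  have two_in: "c = 1 \<or> c = s + 1"
    if "(a, c) \<in> parcs (hat_infty_digraph s r)" "(b, c) \<in> parcs (hat_infty_digraph s r)" "a \<noteq> b"
    for a b c
    using that assms unfolding arc' by auto
  have from1: "(f 1, f 2) \<in> parcs (hat_infty_digraph s r)"
      "(f 1, f (r + 1)) \<in> parcs (hat_infty_digraph s r)"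
    and fromr: "(f r, f 1) \<in> parcs (hat_infty_digraph s r)"
      "(f r, f (r + 1)) \<in> parcs (hat_infty_digraph s r)"
    and to1: "(f (r + s - 1), f 1) \<in> parcs (hat_infty_digraph s r)"
    using assms by (simp_all add: img)
  have distinct: "f 2 \<noteq> f (r + 1)" "f r \<noteq> f (r + s - 1)" "f 1 \<noteq> f r" "f 1 \<noteq> f (r + 1)"
    using assms by (simp_all add: neq)
  \<comment> \<open>\<open>f 1\<close> inherits two out-neighbours and two in-neighbours, and
    \<open>1\<close> is the only vertex in both lists.\<close>
  have f1: "f 1 = 1"
    using two_out[OF from1 distinct(1)] two_in[OF fromr(1) to1 distinct(2)] assms by auto
  have fr: "f r = s"
    using two_out[OF fromr distinct(4)] f1 distinct(3) by auto
  have fr1: "f (r + 1) = s + 1"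
    using two_in[OF from1(2) fromr(2) distinct(3)] f1 distinct(4) by auto
  \<comment> \<open>Since \<open>i < r < s\<close>, the out-neighbours of \<open>i\<close> in the
    target are \<open>i + 1\<close> and, for \<open>i = 1\<close> only, \<open>s + 1\<close>. The
    latter is already the image of \<open>r + 1\<close>. At \<open>i = r\<close> this contradicts
    \<open>f r = s\<close>.\<close>
  have "f i = i" if "1 \<le> i" "i \<le> r" for i
    using that
  proof (induction i rule: dec_induct)
    case base
    show ?case by (rule f1)
  next
    case (step i)
    then have fi: "f i = i"
      by simp
    have "(i, f (i + 1)) \<in> parcs (hat_infty_digraph s r)"
      using img[of i "i + 1"] step assms fi by auto
    moreover have "f (i + 1) \<noteq> s + 1"
      using neq[of "i + 1" "r + 1"] fr1 step assms by auto
    ultimately show ?case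
      using step assms unfolding arc' by auto
  qed
  then have "f r = r"
    using assms by simp
  with fr assms show False
    by simp
qed

section \<open>The complementarity spectrum of a hatted digraph\<close>

text \<open>Apart from \<open>1\<close>, \<open>p\<close> and \<open>p + q - 1\<close>, every vertex
  has its successor as only out-neighbour, so just these three get separate equations.\<close>

lemma mem_spectrum_hat_infty_iff_local:
  assumes "2 \<le> p" "2 \<le> q"
  shows "l \<in> digraph_comp_spectrum (with_proj (hat_infty_digraph p q)) \<longleftrightarrow>
    (\<exists>x. (\<forall>v\<in>{1..<p + q}. 0 \<le> x v) \<and> (\<exists>v\<in>{1..<p + q}. 0 < x v) \<and>
       (0 < x 1 \<longrightarrow> x 2 + x (p + 1) = l * x 1) \<and>
       (0 < x p \<longrightarrow> x 1 + x (p + 1) = l * x p) \<and>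
       (0 < x (p + q - 1) \<longrightarrow> x 1 = l * x (p + q - 1)) \<and>
       (\<forall>v. 2 \<le> v \<and> v < p + q - 1 \<and> v \<noteq> p \<and> 0 < x v \<longrightarrow> x (v + 1) = l * x v))"
    (is "?L \<longleftrightarrow> ?R")
proof -
  let ?D = "hat_infty_digraph p q"
  define S where "S v = {w. w \<in> pverts ?D \<and> (v, w) \<in> parcs ?D}" for v
  have arc: "(u, v) \<in> parcs ?D \<longleftrightarrow>
      1 \<le> u \<and> u < p + q - 1 \<and> v = u + 1 \<or> u = p + q - 1 \<and> v = 1 \<or> u = p \<and> v = 1 \<or>
      u = 1 \<and> v = p + 1" for u v
    unfolding parcs_hat_infty[OF assms] by auto
  note S = S_def arc pverts_hat_infty[OF assms]
  have "S 1 = {2, p + 1}" "S p = {1, p + 1}" "S (p + q - 1) = {1}"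
    using assms by (auto simp: S)
  then have sums: "sum x (S 1) = x 2 + x (p + 1)" "sum x (S p) = x 1 + x (p + 1)"
    "sum x (S (p + q - 1)) = x 1" for x :: "nat \<Rightarrow> real"
    using assms by simp_all
  have inner: "sum x (S v) = x (v + 1)" if "2 \<le> v" "v < p + q - 1" "v \<noteq> p"
    for v and x :: "nat \<Rightarrow> real"
  proof -
    have "S v = {v + 1}"
      using that assms by (auto simp: S)
    then show ?thesis by simp
  qed
  have split: "(\<forall>v\<in>{1..<p + q}. Q v) \<longleftrightarrow>
      Q 1 \<and> Q p \<and> Q (p + q - 1) \<and> (\<forall>v. 2 \<le> v \<and> v < p + q - 1 \<and> v \<noteq> p \<longrightarrow> Q v)" for Q
  proof -
    have "v = 1 \<or> v = p \<or> v = p + q - 1 \<or> 2 \<le> v \<and> v < p + q - 1 \<and> v \<noteq> p"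
      if "v \<in> {1..<p + q}" for v
      using that by auto
    moreover have "1 \<in> {1..<p + q}" "p \<in> {1..<p + q}" "p + q - 1 \<in> {1..<p + q}"
      using assms by auto
    moreover have "v \<in> {1..<p + q}" if "2 \<le> v" "v < p + q - 1" for v
      using that by auto
    ultimately show ?thesis
      by metis
  qed
  have fin: "finite (verts (with_proj ?D))"
    by (simp add: pverts_hat_infty[OF assms])
  have "?L \<longleftrightarrow> (\<exists>x. (\<forall>v\<in>{1..<p + q}. 0 \<le> x v) \<and> (\<exists>v\<in>{1..<p + q}. 0 < x v) \<and>
      (\<forall>v\<in>{1..<p + q}. 0 < x v \<longrightarrow> sum x (S v) = l * x v))"
    unfolding mem_digraph_comp_spectrum_iff[OF fin] S_def by (simp add: pverts_hat_infty[OF assms])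
  also have "\<dots> \<longleftrightarrow> ?R"
    unfolding split[of "\<lambda>v. 0 < _ v \<longrightarrow> _ v"] sums by (simp add: inner conj_assoc imp_conjL cong: imp_cong)
  finally show ?thesis .
qed

text \<open>The recurrence is available only at positive entries; since \<open>l\<close> is
  positive, positivity passes to the next entry and the recurrence never stops applying.\<close>

lemma geometric_on_path:
  fixes x :: "nat \<Rightarrow> 'a :: linordered_field"
  assumes "a \<le> b" "0 < l" "0 < x a" "\<And>v. a \<le> v \<Longrightarrow> v < b \<Longrightarrow> 0 < x v \<Longrightarrow> x (v + 1) = l * x v"
  shows "x b = l ^ (b - a) * x a"
  using assms(1,4)
proof (induction b rule: dec_induct)
  case (step b)
  then have b: "x b = l ^ (b - a) * x a"
    by simp
  then have "0 < x b"
    using assms(2,3) by simp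
  then have "x (b + 1) = l * x b"
    using step by simp
  then show ?case
    using step b by (simp add: Suc_diff_le)
qed simp

lemma characteristic_equation_imp_mem_spectrum:
  assumes "2 \<le> p" "2 \<le> q" "0 < l" and root: "l ^ (p + q - 1) = l ^ (p - 1) + l ^ (q - 1) + 1"
  shows "l \<in> digraph_comp_spectrum (with_proj (hat_infty_digraph p q))"
proof -
  \<comment> \<open>Witness with full support: start from \<open>x (p + 1) = l ^ (p - 1)\<close> and
    go along the second path; the equation at \<open>p + q - 1\<close> gives \<open>x 1\<close>, and
    the one at \<open>p\<close> gives \<open>x 2 = l ^ (q - 1) + 1\<close>.\<close>
  define x where "x v = (if v = 1 then l ^ (p + q - 2) else if v \<le> p then (l ^ (q - 1) + 1) * l ^ (v - 2)
    else l ^ (v - 2))" for v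
  \<comment> \<open>Writing \<open>p\<close> and \<open>q\<close> as double successors removes the
    truncated subtractions in the exponents.\<close>
  obtain a where a: "p = Suc (Suc a)"
    using assms(1) by (metis add_2_eq_Suc le_Suc_ex)
  obtain b where b: "q = Suc (Suc b)"
    using assms(2) by (metis add_2_eq_Suc le_Suc_ex)
  have pos: "0 < x v" for v
    using assms(3) by (simp add: x_def add_pos_pos)
  \<comment> \<open>The equation at vertex \<open>1\<close> is exactly the characteristic equation;
    the others hold by construction.\<close>
  have at1: "x 2 + x (p + 1) = l * x 1"
    using root by (simp add: x_def a b)
  have atp: "x 1 + x (p + 1) = l * x p"
    by (simp add: x_def a b algebra_simps power_add)
  have last: "x 1 = l * x (p + q - 1)"
    by (simp add: x_def a b)
  have inner: "x (v + 1) = l * x v" if v: "2 \<le> v" "v \<noteq> p" for v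
  proof -
    obtain c where c: "v = Suc (Suc c)"
      using v(1) by (metis add_2_eq_Suc le_Suc_ex)
    show ?thesis
    proof (cases "v < p")
      case True
      then show ?thesis
        by (simp add: x_def c algebra_simps)
    next
      case False
      with v(2) have "\<not> v \<le> p"
        by simp
      then show ?thesis
        by (simp add: x_def c algebra_simps)
    qed
  qed
  have "\<exists>v\<in>{1..<p + q}. 0 < x v"
    using pos assms(1) by (intro bexI[of _ 1]) auto
  then show ?thesis
    unfolding mem_spectrum_hat_infty_iff_local[OF assms(1,2)]
    using less_imp_le[OF pos] at1 atp last inner by blast
qed

lemma mem_spectrum_hat_infty_imp:
  assumes "2 \<le> p" "2 \<le> q" and l: "l \<in> digraph_comp_spectrum (with_proj (hat_infty_digraph p q))"
  shows "l = 0 \<or> l = 1 \<or> 0 < l \<and> l ^ (p + q - 1) = l ^ (p - 1) + l ^ (q - 1) + 1"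
proof -
  obtain x where x: "\<forall>v\<in>{1..<p + q}. 0 \<le> x v" "\<exists>v\<in>{1..<p + q}. 0 < x v"
    "0 < x 1 \<longrightarrow> x 2 + x (p + 1) = l * x 1" "0 < x p \<longrightarrow> x 1 + x (p + 1) = l * x p"
    "0 < x (p + q - 1) \<longrightarrow> x 1 = l * x (p + q - 1)"
    "\<forall>v. 2 \<le> v \<and> v < p + q - 1 \<and> v \<noteq> p \<and> 0 < x v \<longrightarrow> x (v + 1) = l * x v"
    using l unfolding mem_spectrum_hat_infty_iff_local[OF assms(1,2)] by (elim exE conjE)
  note nonneg = x(1)[rule_format] and pos = x(2) and at1 = x(3)[rule_format]
    and atp = x(4)[rule_format] and last = x(5)[rule_format]
  have inner: "x (v + 1) = l * x v" if "2 \<le> v" "v < p + q - 1" "v \<noteq> p" "0 < x v" for v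
    using x(6) that by blast
  have ge0: "0 \<le> x 1" "0 \<le> x 2" "0 \<le> x (p + 1)"
    using assms(1,2) by (auto intro: nonneg)
  \<comment> \<open>At any vertex of the support, \<open>l * x v\<close> is a sum of nonnegative
    entries.\<close>
  have l_ge0: "0 \<le> l"
  proof -
    obtain v where v: "v \<in> {1..<p + q}" "0 < x v"
      using pos by blast
    consider "v = 1" | "v = p" | "v = p + q - 1" | "2 \<le> v" "v < p + q - 1" "v \<noteq> p"
      using v(1) by fastforce
    then have "0 \<le> l * x v"
    proof cases
      case 4
      then have "0 \<le> x (v + 1)"
        by (intro nonneg) auto
      then show ?thesis
        using inner 4 v(2) by simp
    qed (use v at1 atp last ge0 in auto)
    with v(2) show ?thesis
      by (simp add: zero_le_mult_iff)
  qed
  show ?thesis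
  proof (cases "l = 0")
    case False
    with l_ge0 have l_pos: "0 < l"
      by simp
    \<comment> \<open>The second path leads from \<open>v\<close> to \<open>p + q - 1\<close>, and
      one more arc returns to \<open>1\<close>.\<close>
    have second: "x 1 = l ^ (p + q - v) * x v" if v: "p < v" "v < p + q" "0 < x v" for v
    proof -
      have "x (p + q - 1) = l ^ (p + q - 1 - v) * x v"
        using v l_pos inner assms(1) by (intro geometric_on_path) auto
      moreover from this have "0 < x (p + q - 1)"
        using v(3) l_pos by simp
      moreover have "p + q - v = Suc (p + q - 1 - v)"
        using v by simp
      ultimately show ?thesis
        using last by (simp add: mult.assoc)
    qed
    \<comment> \<open>The first path ends at \<open>p\<close>, whose two out-neighbours are
      \<open>1\<close> and \<open>p + 1\<close>; hence the sum on the left.\<close>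
    have first: "x 1 + x (p + 1) = l ^ (p + 1 - v) * x v" if v: "2 \<le> v" "v \<le> p" "0 < x v" for v
    proof -
      have "x p = l ^ (p - v) * x v"
        using v l_pos inner assms(2) by (intro geometric_on_path) auto
      moreover from this have "0 < x p"
        using v(3) l_pos by simp
      moreover have "p + 1 - v = Suc (p - v)"
        using v by simp
      ultimately show ?thesis
        using atp by (simp add: mult.assoc)
    qed
    \<comment> \<open>If \<open>x 1\<close> vanished, \<open>second\<close> would kill the second
      path, including \<open>x (p + 1)\<close>, and then \<open>first\<close> would kill the first
      path.\<close>
    have x1: "0 < x 1"
    proof (rule ccontr)
      assume "\<not> 0 < x 1"
      with ge0 have x1: "x 1 = 0"
        by simp
      have "\<not> 0 < x v" if "p < v" "v < p + q" for v
        using second[of v] that x1 l_pos by auto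
      moreover from this[of "p + 1"] have y: "x (p + 1) = 0"
        using ge0 assms(2) by simp
      have "\<not> 0 < x v" if "2 \<le> v" "v \<le> p" for v
        using first[OF that] x1 y l_pos by auto
      moreover obtain v where "v \<in> {1..<p + q}" "0 < x v"
        using pos by blast
      moreover from this x1 have "v \<noteq> 1"
        by auto
      ultimately show False
        by (cases "v \<le> p") auto
    qed
    have y: "x 1 = l ^ (q - 1) * x (p + 1)" if "0 < x (p + 1)"
      using second[of "p + 1"] that assms by simp
    have z: "x 1 + x (p + 1) = l ^ (p - 1) * x 2" if "0 < x 2"
      using first[of 2] that assms by (simp add: numeral_2_eq_2)
    have pow_p: "l ^ p = l ^ (p - 1) * l" and pow_q: "l ^ q = l ^ (q - 1) * l"
      by (rule power_minus_mult[symmetric], use assms in simp)+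
    have l1: "l = 1" if "k > 0" "l ^ k = 1" for k
      using that l_pos power_eq_imp_eq_base[of l k 1] by simp
    have "0 < x 2 + x (p + 1)"
      using at1[OF x1] l_pos x1 by simp
    with ge0 have "x (p + 1) = 0 \<and> 0 < x 2 \<or> x 2 = 0 \<and> 0 < x (p + 1) \<or> 0 < x 2 \<and> 0 < x (p + 1)"
      by linarith
    then consider "x (p + 1) = 0" "0 < x 2" | "x 2 = 0" "0 < x (p + 1)"
      | "0 < x 2" "0 < x (p + 1)"
      by blast
    \<comment> \<open>If only one out-neighbour of \<open>1\<close> is in the support, going once
      around the corresponding cycle gives \<open>l ^ p = 1\<close> or \<open>l ^ q = 1\<close>. If
      both are, \<open>x 1\<close> and \<open>x 2\<close> are expressed through
      \<open>x (p + 1)\<close>, which then cancels.\<close>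
    then show ?thesis
    proof cases
      case 1
      then have "x 1 = l ^ p * x 1"
        using at1[OF x1] z pow_p by simp
      then show ?thesis
        using x1 l1[of p] assms(1) by simp
    next
      case 2
      then have "x 1 = l ^ q * x 1"
        using at1[OF x1] y pow_q by simp
      then show ?thesis
        using x1 l1[of q] assms(2) by simp
    next
      case 3
      let ?y = "x (p + 1)"
      have x2: "x 2 = (l ^ q - 1) * ?y"
        using at1[OF x1] y[OF 3(2)] pow_q by (simp add: algebra_simps)
      have "l ^ (q - 1) * ?y + ?y = l ^ (p - 1) * ((l ^ q - 1) * ?y)"
        using z[OF 3(1)] unfolding y[OF 3(2)] x2 .
      then have "(l ^ (q - 1) + 1) * ?y = l ^ (p - 1) * (l ^ q - 1) * ?y"
        by (simp only: distrib_right mult.assoc mult_1_left)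
      then have "l ^ (q - 1) + 1 = l ^ (p - 1) * (l ^ q - 1)"
        using 3(2) by simp
      moreover have "l ^ (p + q - 1) = l ^ (p - 1) * l ^ q"
        using assms(1) by (simp flip: power_add)
      ultimately show ?thesis
        using l_pos by (simp add: algebra_simps)
    qed
  qed simp
qed

text \<open>A single vertex without a loop serves as support.\<close>

lemma zero_mem_spectrum_hat_infty:
  assumes "2 \<le> p" "2 \<le> q"
  shows "0 \<in> digraph_comp_spectrum (with_proj (hat_infty_digraph p q))"
  unfolding mem_spectrum_hat_infty_iff_local[OF assms]
  using assms by (intro exI[of _ "\<lambda>v. if v = 1 then 1 else 0"]) auto

text \<open>The first cycle is an induced subdigraph, so on its indicator each of its vertices sees
  exactly one supported out-neighbour.\<close>

lemma one_mem_spectrum_hat_infty: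
  assumes "2 \<le> p" "2 \<le> q"
  shows "1 \<in> digraph_comp_spectrum (with_proj (hat_infty_digraph p q))"
  unfolding mem_spectrum_hat_infty_iff_local[OF assms]
  using assms by (intro exI[of _ "\<lambda>v. if v \<le> p then 1 else 0"]) (auto intro!: bexI[of _ 1])

lemma spectrum_hat_infty:
  assumes "2 \<le> p" "2 \<le> q"
  shows "digraph_comp_spectrum (with_proj (hat_infty_digraph p q)) =
    {0, 1} \<union> {l. 0 < l \<and> l ^ (p + q - 1) = l ^ (p - 1) + l ^ (q - 1) + 1}"
  using mem_spectrum_hat_infty_imp[OF assms] characteristic_equation_imp_mem_spectrum[OF assms]
    zero_mem_spectrum_hat_infty[OF assms] one_mem_spectrum_hat_infty[OF assms]
  by blast

section \<open>The characteristic equation\<close>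

text \<open>Scaling a root by \<open>t > 1\<close> multiplies the left side by \<open>t ^ n\<close>,
  but the terms on the right by at most \<open>t ^ n\<close>, and the constant term by strictly
  less.\<close>

lemma positive_root_unique:
  fixes x y :: "'a :: linordered_field"
  assumes "0 < x" "0 < y" "a \<le> n" "b \<le> n" "0 < n"
    and "x ^ n = x ^ a + x ^ b + 1" "y ^ n = y ^ a + y ^ b + 1"
  shows "x = y"
proof -
  have False if "0 < x" "x < y" "x ^ n = x ^ a + x ^ b + 1" "y ^ n = y ^ a + y ^ b + 1" for x y :: 'a
  proof -
    define t where "t = y / x"
    have t: "1 < t" and y: "y = t * x"
      using that(1,2) by (simp_all add: t_def)
    have "y ^ n = t ^ n * x ^ a + t ^ n * x ^ b + t ^ n"
      unfolding y power_mult_distrib that(3) by (simp add: algebra_simps)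
    moreover have "t ^ a * x ^ a \<le> t ^ n * x ^ a" "t ^ b * x ^ b \<le> t ^ n * x ^ b"
      using t that(1) assms(3,4) by (auto intro!: mult_right_mono power_increasing)
    moreover have "1 < t ^ n"
      using t assms(5) by simp
    ultimately have "y ^ a + y ^ b + 1 < y ^ n"
      unfolding y power_mult_distrib by linarith
    with that(4) show False
      by simp
  qed
  from this[of x y] this[of y x] assms show ?thesis
    by (meson linorder_neqE)
qed

lemma positive_root_exists:
  assumes "2 \<le> r" "2 \<le> s"
  shows "\<exists>x>0. (x::real) ^ (r + s - 1) = x ^ (r - 1) + x ^ (s - 1) + 1"
proof -
  let ?f = "\<lambda>x::real. x ^ (r + s - 1) - x ^ (r - 1) - x ^ (s - 1) - 1"
  define a b where "a = (2::real) ^ (r - 1)" and "b = (2::real) ^ (s - 1)"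
  have "(2::real) ^ (r + s - 1) = 2 * (a * b)"
  proof -
    have "r + s - 1 = Suc ((r - 1) + (s - 1))"
      using assms by simp
    then show ?thesis
      by (simp only: a_def b_def power_add power_Suc)
  qed
  moreover have "2 \<le> a" "2 \<le> b"
    using assms power_increasing[of 1 "r - 1" "2::real"] power_increasing[of 1 "s - 1" "2::real"]
    by (simp_all add: a_def b_def)
  \<comment> \<open>The value at \<open>2\<close> is \<open>2 * (a * b) - a - b - 1\<close>, which
    equals \<open>(a - 1) * (b - 1) + (a * b - 2)\<close>.\<close>
  then have "0 \<le> (a - 1) * (b - 1)" "4 \<le> a * b"
    using mult_mono[of 2 a 2 b] by simp_all
  ultimately have "a + b + 1 \<le> 2 ^ (r + s - 1)"
    by (simp add: algebra_simps)
  then have "0 \<le> ?f 2"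
    by (simp add: a_def b_def)
  \<comment> \<open>The value at \<open>1\<close> is \<open>-2\<close>, so there is a sign change on
    the interval from \<open>1\<close> to \<open>2\<close>.\<close>
  then have "\<exists>x\<ge>1. x \<le> 2 \<and> ?f x = 0"
    by (intro IVT') (auto intro!: continuous_intros)
  then obtain x where "1 \<le> x" "?f x = 0"
    by blast
  then show ?thesis
    by (intro exI[of _ x]) simp
qed

theorem theorem6p3:
  fixes r s n :: nat
  assumes "2 \<le> r" and "r < s" and "n = r + s - 1"
  shows "\<not> digraph_iso (with_proj (hat_infty_digraph r s)) (with_proj (hat_infty_digraph s r))
    \<and> card (verts (with_proj (hat_infty_digraph r s))) = n
    \<and> card (verts (with_proj (hat_infty_digraph s r))) = n
    \<and> card (arcs (with_proj (hat_infty_digraph r s))) = r + s + 1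
    \<and> card (arcs (with_proj (hat_infty_digraph s r))) = r + s + 1
    \<and> (\<exists>\<rho> :: real.
          (let P = monom 1 n - monom 1 (n - r) - monom 1 (n - s) - 1 :: real poly
           in poly P \<rho> = 0 \<and> (\<forall>x. poly P x = 0 \<longrightarrow> x \<le> \<rho>))
        \<and> digraph_comp_spectrum (with_proj (hat_infty_digraph r s)) = {0, 1, \<rho>}
        \<and> digraph_comp_spectrum (with_proj (hat_infty_digraph s r)) = {0, 1, \<rho>})"
proof -
  have s: "2 \<le> s"
    using assms by simp
  obtain \<rho> :: real where \<rho>: "0 < \<rho>" "\<rho> ^ (r + s - 1) = \<rho> ^ (r - 1) + \<rho> ^ (s - 1) + 1"
    using positive_root_exists[OF assms(1) s] by blast
  have unique: "x = \<rho>" if "0 < x" "x ^ (r + s - 1) = x ^ (r - 1) + x ^ (s - 1) + 1" for x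
    using positive_root_unique[of x \<rho> "r - 1" "r + s - 1" "s - 1"] that \<rho> assms by simp
  have roots: "{l. 0 < l \<and> l ^ (r + s - 1) = l ^ (r - 1) + l ^ (s - 1) + 1} = {\<rho>}"
    using unique \<rho> by blast
  \<comment> \<open>This identifies the exponents of \<open>P\<close> with those of the
    characteristic equation.\<close>
  have n: "n - r = s - 1" "n - s = r - 1"
    using assms by auto
  define P :: "real poly" where "P = monom 1 n - monom 1 (n - r) - monom 1 (n - s) - 1"
  have P: "poly P x = 0 \<longleftrightarrow> x ^ (r + s - 1) = x ^ (r - 1) + x ^ (s - 1) + 1" for x
    unfolding P_def n unfolding assms(3) by (auto simp: poly_monom)
  have root: "poly P \<rho> = 0"
    using \<rho>(2) unfolding P .
  \<comment> \<open>The unique positive root is the largest real root, since any other root is at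
    most zero.\<close>
  have max: "x \<le> \<rho>" if "poly P x = 0" for x
  proof (cases "0 < x")
    case True
    then show ?thesis
      using unique that unfolding P by blast
  next
    case False
    with \<rho>(1) show ?thesis by simp
  qed
  have "digraph_comp_spectrum (with_proj (hat_infty_digraph r s)) = {0, 1, \<rho>}"
    unfolding spectrum_hat_infty[OF assms(1) s] roots by auto
  moreover have "digraph_comp_spectrum (with_proj (hat_infty_digraph s r)) = {0, 1, \<rho>}"
  proof -
    \<comment> \<open>Exchanging \<open>r\<close> and \<open>s\<close> only permutes the terms of
      the equation.\<close>
    have "{l. 0 < l \<and> l ^ (s + r - 1) = l ^ (s - 1) + l ^ (r - 1) + 1} = {\<rho>}"
      using roots by (simp add: ac_simps)
    then show ?thesis
      unfolding spectrum_hat_infty[OF s assms(1)] by auto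
  qed
  moreover have "card (pverts (hat_infty_digraph r s)) = n" "card (pverts (hat_infty_digraph s r)) = n"
    using assms s by (simp_all add: pverts_hat_infty)
  moreover have "card (parcs (hat_infty_digraph r s)) = r + s + 1"
    "card (parcs (hat_infty_digraph s r)) = r + s + 1"
    using assms s by (simp_all add: card_parcs_hat_infty)
  ultimately show ?thesis
    unfolding Let_def P_def[symmetric] with_proj_simps
    using not_digraph_iso_hat_infty[OF assms(1,2)] root max by blast
qed

end
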